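(* Assume all channel matrices $\mathbf{H}^{(c)}$, $c=1,\dots,C$, have full row rank. Let $\mathbf{X}=(\mathbf{X}^{(1)},\dots,\mathbf{X}^{(C)})\in\mathcal{M}$ and let $\mathbf{V}$ be the corresponding beamformer given by $\mathbf{V}^{(c)}=(\mathbf{H}^{(c)})^{\mathrm H}\mathbf{X}^{(c)}$ for all $c$. Then $\mathbf{X}$ is a stationary point of $$\text{minimize}_{\mathbf{X}\in\mathcal{M}}\ -\sum_{k=1}^K\omega_k\hat R_k(\mathbf{X})$$ if and only if $\mathbf{V}$ is a stationary point of $$\text{maximize}_{\mathbf{V}}\ \sum_{k=1}^K\omega_kR_k(\mathbf{V})\quad\text{subject to}\quad\|\mathbf{V}^{(c)}\|_F^2=P_c,\quad c=1,\dots,C.$$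
   Context: Setting. Positive integers $K$ (users), $C$ (antenna clusters), $L$ (antennas per cluster), $N_r$ (receive antennas per user), $N_t=LC$, and $d_k\le\min\{N_t,N_r\}$, $1\le k\le K$; $D=\sum_k d_k$. Constants $\omega_k>0$, $\sigma_k^2>0$, $P_c>0$. Channels $\mathbf{H}_k^{(c)}\in\mathbb{C}^{N_r\times L}$; $\mathbf{H}_k=[\mathbf{H}_k^{(1)},\dots,\mathbf{H}_k^{(C)}]\in\mathbb{C}^{N_r\times N_t}$; $\mathbf{H}^{(c)}\in\mathbb{C}^{KN_r\times L}$ is the vertical stack of $\mathbf{H}_1^{(c)},\dots,\mathbf{H}_K^{(c)}$, assumed of rank $KN_r$. $^{\mathrm H}$ is conjugate transpose. Original variables: $\mathbf{V}_k^{(c)}\in\mathbb{C}^{L\times d_k}$; $\mathbf{V}_k\in\mathbb{C}^{N_t\times d_k}$ is the vertical stack of $\mathbf{V}_k^{(1)},\dots,\mathbf{V}_k^{(C)}$; $\mathbf{V}^{(c)}=[\mathbf{V}_1^{(c)},\dots,\mathbf{V}_K^{(c)}]\in\mathbb{C}^{L\times D}$. Rates: $R_k(\mathbf{V})=\log\det(\mathbf{I}+\mathbf{V}_k^{\mathrm H}\mathbf{H}_k^{\mathrm H}\mathbf{F}_k^{-1}\mathbf{H}_k\mathbf{V}_k)$, $\mathbf{F}_k=\sigma_k^2\mathbf{I}+\sum_{j\ne k}\mathbf{H}_k\mathbf{V}_j\mathbf{V}_j^{\mathrm H}\mathbf{H}_k^{\mathrm H}$. Reduced variables: $\mathbf{X}_k^{(c)}\in\mathbb{C}^{KN_r\times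 d_k}$; $\mathbf{X}_k\in\mathbb{C}^{CKN_r\times d_k}$ is the vertical stack of $\mathbf{X}_k^{(1)},\dots,\mathbf{X}_k^{(C)}$; $\mathbf{X}^{(c)}=[\mathbf{X}_1^{(c)},\dots,\mathbf{X}_K^{(c)}]\in\mathbb{C}^{KN_r\times D}$. Put $\mathbf{G}_k=[\mathbf{H}_k^{(1)}(\mathbf{H}^{(1)})^{\mathrm H},\dots,\mathbf{H}_k^{(C)}(\mathbf{H}^{(C)})^{\mathrm H}]\in\mathbb{C}^{N_r\times CKN_r}$ and $$\hat R_k(\mathbf{X})=\log\det\Big(\mathbf{I}+\mathbf{X}_k^{\mathrm H}\mathbf{G}_k^{\mathrm H}\Big(\sigma_k^2\mathbf{I}+\sum_{j\neq k}\mathbf{G}_k\mathbf{X}_j\mathbf{X}_j^{\mathrm H}\mathbf{G}_k^{\mathrm H}\Big)^{-1}\mathbf{G}_k\mathbf{X}_k\Big).$$ Manifold: $\mathcal{M}=\mathcal{M}_1\times\cdots\times\mathcal{M}_C$ with $\mathcal{M}_c=\{\mathbf{X}^{(c)}\in\mathbb{C}^{KN_r\times D}:\operatorname{tr}((\mathbf{X}^{(c)})^{\mathrm H}\mathbf{Q}^{(c)}\mathbf{X}^{(c)})=P_c\}$, $\mathbf{Q}^{(c)}=\mathbf{H}^{(c)}(\mathbf{H}^{(c)})^{\mathrm H}$. Stationarity. In both problems, a stationary point is a feasible point at which the first-order (Lagrange) conditions hold, equivalently at which the Riemannian gradient of the objective on the feasible manifold (with the metric induced by $\Re\operatorname{tr}(\mathbf{A}^{\mathrm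 H}\mathbf{B})$) vanishes. Explicitly, with $f=-\sum_k\omega_kR_k$ and $\hat f=-\sum_k\omega_k\hat R_k$: $\mathbf{V}$ (feasible) is stationary iff there are $\mu_c\in\mathbb{R}$ with $\nabla_{\mathbf{V}^{(c)}}f(\mathbf{V})+\mu_c\mathbf{V}^{(c)}=\mathbf{0}$ for all $c$; $\mathbf{X}\in\mathcal{M}$ is stationary iff there are $\mu_c\in\mathbb{R}$ with $\nabla_{\mathbf{X}^{(c)}}\hat f(\mathbf{X})+\mu_c\mathbf{Q}^{(c)}\mathbf{X}^{(c)}=\mathbf{0}$ for all $c$, where $\nabla$ is the Euclidean gradient with respect to the complex matrix variable (overall positive scaling immaterial). *)

theory Defs
  imports
    Complex_Main
    "Jordan_Normal_Form.Schur_Decomposition"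
    "Jordan_Normal_Form.Gauss_Jordan_Elimination"
    "Jordan_Normal_Form.DL_Rank"
begin

(* Users k < K, clusters c < C, antennas and matrix entries are indexed from 0. *)

section \<open>Matrices\<close>

definition mat_trace :: "complex mat \<Rightarrow> complex" where
  "mat_trace A = (\<Sum>i<dim_row A. A $$ (i, i))"

definition frob_norm :: "complex mat \<Rightarrow> real" where
  "frob_norm A = sqrt (\<Sum>i<dim_row A. \<Sum>j<dim_col A. (cmod (A $$ (i, j)))\<^sup>2)"

definition msum :: "nat \<Rightarrow> nat \<Rightarrow> nat set \<Rightarrow> (nat \<Rightarrow> complex mat) \<Rightarrow> complex mat" where
  "msum nr nc I A = mat nr nc (\<lambda>(i, j). \<Sum>l\<in>I. A l $$ (i, j))"

(* vcat / hcat: vertical stack / horizontal concatenation of the n blocks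
   A 0, ..., A (n - 1), each of size nr x nc. *)
definition vcat :: "nat \<Rightarrow> nat \<Rightarrow> nat \<Rightarrow> (nat \<Rightarrow> complex mat) \<Rightarrow> complex mat" where
  "vcat nr nc n A = mat (n * nr) nc (\<lambda>(i, j). A (i div nr) $$ (i mod nr, j))"

definition hcat :: "nat \<Rightarrow> nat \<Rightarrow> nat \<Rightarrow> (nat \<Rightarrow> complex mat) \<Rightarrow> complex mat" where
  "hcat nr nc n A = mat nr (n * nc) (\<lambda>(i, j). A (j div nc) $$ (i, j mod nc))"

(* The k-th column block of A = [A_0, ..., A_{K-1}], where A_k has d k columns. *)
definition user_block :: "(nat \<Rightarrow> nat) \<Rightarrow> complex mat \<Rightarrow> nat \<Rightarrow> complex mat" where
  "user_block d A k = mat (dim_row A) (d k) (\<lambda>(i, j). A $$ (i, (\<Sum>l<k. d l) + j))"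


section \<open>Euclidean gradient\<close>

(* Z is a tuple of complex matrices. G is the gradient of the real-valued function f at Z with
   respect to the block Z c, for the real inner product Re tr(A^H B): the partial Frechet derivative
   of f in the direction E (same size as Z c) is Re tr(G^H E). *)
definition has_block_gradient ::
  "((nat \<Rightarrow> complex mat) \<Rightarrow> real) \<Rightarrow> (nat \<Rightarrow> complex mat) \<Rightarrow> nat \<Rightarrow> complex mat \<Rightarrow> bool" where
  "has_block_gradient f Z c G \<longleftrightarrow>
     G \<in> carrier_mat (dim_row (Z c)) (dim_col (Z c)) \<and>
     (\<forall>\<epsilon>>0. \<exists>\<delta>>0. \<forall>E \<in> carrier_mat (dim_row (Z c)) (dim_col (Z c)). frob_norm E < \<delta> \<longrightarrow>
        \<bar>f (Z(c := Z c + E)) - f Z - Re (mat_trace (mat_adjoint G * E))\<bar> \<le> \<epsilon> * frob_norm E)"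


section \<open>Channels and rates\<close>

(* H k c is the Nr x L channel from cluster c to user k. *)

definition user_channel ::
  "nat \<Rightarrow> nat \<Rightarrow> nat \<Rightarrow> (nat \<Rightarrow> nat \<Rightarrow> complex mat) \<Rightarrow> nat \<Rightarrow> complex mat" where
  "user_channel C L Nr H k = hcat Nr L C (\<lambda>c. H k c)"

definition cluster_channel ::
  "nat \<Rightarrow> nat \<Rightarrow> nat \<Rightarrow> (nat \<Rightarrow> nat \<Rightarrow> complex mat) \<Rightarrow> nat \<Rightarrow> complex mat" where
  "cluster_channel K L Nr H c = vcat Nr L K (\<lambda>k. H k c)"

definition gram ::
  "nat \<Rightarrow> nat \<Rightarrow> nat \<Rightarrow> (nat \<Rightarrow> nat \<Rightarrow> complex mat) \<Rightarrow> nat \<Rightarrow> complex mat" where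
  "gram K L Nr H c = cluster_channel K L Nr H c * mat_adjoint (cluster_channel K L Nr H c)"

definition reduced_channel ::
  "nat \<Rightarrow> nat \<Rightarrow> nat \<Rightarrow> nat \<Rightarrow> (nat \<Rightarrow> nat \<Rightarrow> complex mat) \<Rightarrow> nat \<Rightarrow> complex mat" where
  "reduced_channel K C L Nr H k =
     hcat Nr (K * Nr) C (\<lambda>c. H k c * mat_adjoint (cluster_channel K L Nr H c))"

(* Z c holds the L x D (or KNr x D) matrix of cluster c, whose column blocks belong to the users;
   n is its number of rows. *)
definition user_stack ::
  "nat \<Rightarrow> nat \<Rightarrow> (nat \<Rightarrow> nat) \<Rightarrow> (nat \<Rightarrow> complex mat) \<Rightarrow> nat \<Rightarrow> complex mat" where
  "user_stack n C d Z k = vcat n (d k) C (\<lambda>c. user_block d (Z c) k)"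

definition interference_cov ::
  "nat \<Rightarrow> nat \<Rightarrow> (nat \<Rightarrow> real) \<Rightarrow> (nat \<Rightarrow> complex mat) \<Rightarrow> (nat \<Rightarrow> complex mat) \<Rightarrow> nat \<Rightarrow> complex mat" where
  "interference_cov K Nr \<sigma> A B k =
     complex_of_real ((\<sigma> k)\<^sup>2) \<cdot>\<^sub>m 1\<^sub>m Nr +
     msum Nr Nr ({..<K} - {k})
       (\<lambda>j. A k * B j * mat_adjoint (B j) * mat_adjoint (A k))"

(* The covariance is positive definite when \<sigma> k is nonzero, so mat_inverse returns its inverse,
   and the determinant, a complex number for the library, is real and at least 1. *)
definition rate ::
  "nat \<Rightarrow> nat \<Rightarrow> (nat \<Rightarrow> nat) \<Rightarrow> (nat \<Rightarrow> real) \<Rightarrow> (nat \<Rightarrow> complex mat) \<Rightarrow> (nat \<Rightarrow> complex mat) \<Rightarrow> nat \<Rightarrow> real" where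
  "rate K Nr d \<sigma> A B k =
     ln (Re (det (1\<^sub>m (d k) +
       mat_adjoint (B k) * mat_adjoint (A k) *
       the (mat_inverse (interference_cov K Nr \<sigma> A B k)) * A k * B k)))"

definition original_rate ::
  "nat \<Rightarrow> nat \<Rightarrow> nat \<Rightarrow> nat \<Rightarrow> (nat \<Rightarrow> nat) \<Rightarrow> (nat \<Rightarrow> nat \<Rightarrow> complex mat) \<Rightarrow> (nat \<Rightarrow> real) \<Rightarrow>
    (nat \<Rightarrow> complex mat) \<Rightarrow> nat \<Rightarrow> real" where
  "original_rate K C L Nr d H \<sigma> V k =
     rate K Nr d \<sigma> (user_channel C L Nr H) (user_stack L C d V) k"

definition reduced_rate ::
  "nat \<Rightarrow> nat \<Rightarrow> nat \<Rightarrow> nat \<Rightarrow> (nat \<Rightarrow> nat) \<Rightarrow> (nat \<Rightarrow> nat \<Rightarrow> complex mat) \<Rightarrow> (nat \<Rightarrow> real) \<Rightarrow>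
    (nat \<Rightarrow> complex mat) \<Rightarrow> nat \<Rightarrow> real" where
  "reduced_rate K C L Nr d H \<sigma> X k =
     rate K Nr d \<sigma> (reduced_channel K C L Nr H) (user_stack (K * Nr) C d X) k"


section \<open>Feasible sets and stationary points\<close>

(* Only the components c < C of a tuple matter. *)

definition original_feasible ::
  "nat \<Rightarrow> nat \<Rightarrow> nat \<Rightarrow> (nat \<Rightarrow> nat) \<Rightarrow> (nat \<Rightarrow> real) \<Rightarrow> (nat \<Rightarrow> complex mat) set" where
  "original_feasible K C L d P =
     {V. \<forall>c<C. V c \<in> carrier_mat L (\<Sum>k<K. d k) \<and> (frob_norm (V c))\<^sup>2 = P c}"

definition reduced_manifold ::
  "nat \<Rightarrow> nat \<Rightarrow> nat \<Rightarrow> nat \<Rightarrow> (nat \<Rightarrow> nat) \<Rightarrow> (nat \<Rightarrow> nat \<Rightarrow> complex mat) \<Rightarrow> (nat \<Rightarrow> real) \<Rightarrow>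
    (nat \<Rightarrow> complex mat) set" where
  "reduced_manifold K C L Nr d H P =
     {X. \<forall>c<C. X c \<in> carrier_mat (K * Nr) (\<Sum>k<K. d k) \<and>
        mat_trace (mat_adjoint (X c) * gram K L Nr H c * X c) = complex_of_real (P c)}"

definition original_stationary ::
  "nat \<Rightarrow> nat \<Rightarrow> nat \<Rightarrow> nat \<Rightarrow> (nat \<Rightarrow> nat) \<Rightarrow> (nat \<Rightarrow> nat \<Rightarrow> complex mat) \<Rightarrow> (nat \<Rightarrow> real) \<Rightarrow>
    (nat \<Rightarrow> real) \<Rightarrow> (nat \<Rightarrow> real) \<Rightarrow> (nat \<Rightarrow> complex mat) \<Rightarrow> bool" where
  "original_stationary K C L Nr d H \<omega> \<sigma> P V \<longleftrightarrow>
     V \<in> original_feasible K C L d P \<and>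
     (\<exists>\<mu> :: nat \<Rightarrow> real. \<forall>c<C. \<exists>G.
        has_block_gradient (\<lambda>W. - (\<Sum>k<K. \<omega> k * original_rate K C L Nr d H \<sigma> W k)) V c G \<and>
        G + complex_of_real (\<mu> c) \<cdot>\<^sub>m V c = 0\<^sub>m L (\<Sum>k<K. d k))"

definition reduced_stationary ::
  "nat \<Rightarrow> nat \<Rightarrow> nat \<Rightarrow> nat \<Rightarrow> (nat \<Rightarrow> nat) \<Rightarrow> (nat \<Rightarrow> nat \<Rightarrow> complex mat) \<Rightarrow> (nat \<Rightarrow> real) \<Rightarrow>
    (nat \<Rightarrow> real) \<Rightarrow> (nat \<Rightarrow> real) \<Rightarrow> (nat \<Rightarrow> complex mat) \<Rightarrow> bool" where
  "reduced_stationary K C L Nr d H \<omega> \<sigma> P X \<longleftrightarrow>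
     X \<in> reduced_manifold K C L Nr d H P \<and>
     (\<exists>\<mu> :: nat \<Rightarrow> real. \<forall>c<C. \<exists>G.
        has_block_gradient (\<lambda>Y. - (\<Sum>k<K. \<omega> k * reduced_rate K C L Nr d H \<sigma> Y k)) X c G \<and>
        G + complex_of_real (\<mu> c) \<cdot>\<^sub>m (gram K L Nr H c * X c) = 0\<^sub>m (K * Nr) (\<Sum>k<K. d k))"

end

theory Submission
  imports Defs "HOL-Analysis.L2_Norm"
begin

text \<open>The rates depend on a beamformer \<open>W\<close> only through the products \<open>B\<^sub>c W\<^sub>c\<close> with the cluster
  channels, and \<open>Q\<^sub>c = B\<^sub>c B\<^sub>c\<^sup>H\<close> is invertible by the rank assumption. Hence, near \<open>X\<close> and \<open>V\<close>,
  each objective is the other one composed with a linear map: \<open>B\<^sub>c\<^sup>H\<close> takes reduced variables to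
  beamformers, and \<open>Q\<^sub>c\<^sup>-\<^sup>1 B\<^sub>c\<close> goes back, since \<open>Q\<^sub>c Q\<^sub>c\<^sup>-\<^sup>1 B\<^sub>c = B\<^sub>c\<close>. The chain rule multiplies
  gradients by the adjoints \<open>B\<^sub>c\<close> and \<open>B\<^sub>c\<^sup>H Q\<^sub>c\<^sup>-\<^sup>1\<close>, which exchange \<open>V\<^sub>c\<close> and \<open>Q\<^sub>c X\<^sub>c\<close>, so a
  Lagrange condition on one side becomes that of the other with the same multipliers.\<close>

section \<open>Adjoints and associativity of products\<close>

lemma mat_adjoint_dim [simp]:
  "dim_row (mat_adjoint A) = dim_col A" "dim_col (mat_adjoint A) = dim_row A"
  by (simp_all add: mat_adjoint_def)

lemma mat_adjoint_carrier [intro]: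
  "A \<in> carrier_mat m n \<Longrightarrow> mat_adjoint A \<in> carrier_mat n m"
  by auto

lemma mat_adjoint_index [simp]:
  fixes A :: "complex mat"
  assumes "i < dim_col A" "j < dim_row A"
  shows "mat_adjoint A $$ (i, j) = cnj (A $$ (j, i))"
  using assms by (simp add: mat_adjoint_def mat_of_rows_index)

lemma mat_adjoint_mat_adjoint [simp]:
  fixes A :: "complex mat"
  shows "mat_adjoint (mat_adjoint A) = A"
  by (rule eq_matI) auto

lemma mat_adjoint_mult:
  fixes A B :: "complex mat"
  assumes "dim_col A = dim_row B"
  shows "mat_adjoint (A * B) = mat_adjoint B * mat_adjoint A"
  using assms
  by (intro eq_matI) (auto simp: scalar_prod_def mult.commute intro!: sum.cong)

text \<open>The left factor is arbitrary, so that the junk value of \<open>the (mat_inverse F)\<close> for a singular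
  \<open>F\<close>, whose dimensions are unknown, needs no separate treatment.\<close>

lemma mult_assoc_right_dims:
  fixes Y A B :: "'a :: semiring_0 mat"
  assumes "dim_col A = dim_row B"
  shows "Y * A * B = Y * (A * B)"
  using assms
  by (intro eq_matI)
    (auto simp: scalar_prod_def sum_distrib_left sum_distrib_right mult.assoc intro: sum.swap)

section \<open>The Frobenius norm\<close>

lemma frob_norm_sq: "(frob_norm A)\<^sup>2 = (\<Sum>i<dim_row A. \<Sum>j<dim_col A. (cmod (A $$ (i, j)))\<^sup>2)"
  unfolding frob_norm_def by (simp add: sum_nonneg)

lemma frob_norm_nonneg [simp]: "0 \<le> frob_norm A"
  unfolding frob_norm_def by (simp add: sum_nonneg)

text \<open>Cauchy-Schwarz bounds each squared entry by a squared row norm times a squared column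
  norm; summed over all entries, these bounds factor.\<close>

lemma frob_norm_mult_le:
  assumes "dim_col A = dim_row B"
  shows "frob_norm (A * B) \<le> frob_norm A * frob_norm B"
proof -
  have entry: "(cmod ((A * B) $$ (i, j)))\<^sup>2 \<le>
      (\<Sum>l<dim_col A. (cmod (A $$ (i, l)))\<^sup>2) * (\<Sum>l<dim_col A. (cmod (B $$ (l, j)))\<^sup>2)"
    if "i < dim_row A" "j < dim_col B" for i j
  proof -
    have "cmod ((A * B) $$ (i, j)) = cmod (\<Sum>l<dim_col A. A $$ (i, l) * B $$ (l, j))"
      using that assms by (simp add: scalar_prod_def lessThan_atLeast0)
    also have "\<dots> \<le> (\<Sum>l<dim_col A. \<bar>cmod (A $$ (i, l))\<bar> * \<bar>cmod (B $$ (l, j))\<bar>)"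
      by (rule order_trans[OF norm_sum]) (simp add: norm_mult)
    also have "\<dots> \<le> L2_set (\<lambda>l. cmod (A $$ (i, l))) {..<dim_col A} *
        L2_set (\<lambda>l. cmod (B $$ (l, j))) {..<dim_col A}"
      by (rule L2_set_mult_ineq)
    finally have "(cmod ((A * B) $$ (i, j)))\<^sup>2 \<le> (L2_set (\<lambda>l. cmod (A $$ (i, l))) {..<dim_col A} *
        L2_set (\<lambda>l. cmod (B $$ (l, j))) {..<dim_col A})\<^sup>2"
      by (rule power_mono) simp
    then show ?thesis
      by (simp add: power_mult_distrib L2_set_def sum_nonneg)
  qed
  have "(frob_norm (A * B))\<^sup>2 \<le> (\<Sum>i<dim_row A. \<Sum>j<dim_col B.
      (\<Sum>l<dim_col A. (cmod (A $$ (i, l)))\<^sup>2) * (\<Sum>l<dim_col A. (cmod (B $$ (l, j)))\<^sup>2))"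
    unfolding frob_norm_sq index_mult_mat(2,3) by (intro sum_mono entry) simp_all
  also have "\<dots> = (frob_norm A)\<^sup>2 *
      (\<Sum>j<dim_col B. \<Sum>l<dim_row B. (cmod (B $$ (l, j)))\<^sup>2)"
    unfolding frob_norm_sq by (simp add: assms flip: sum_product)
  also have "(\<Sum>j<dim_col B. \<Sum>l<dim_row B. (cmod (B $$ (l, j)))\<^sup>2) = (frob_norm B)\<^sup>2"
    unfolding frob_norm_sq by (rule sum.swap)
  finally show ?thesis
    by (intro power2_le_imp_le[of "frob_norm (A * B)"]) (simp_all add: power_mult_distrib)
qed

lemma mat_trace_adjoint_mult_self:
  "mat_trace (mat_adjoint A * A) = complex_of_real ((frob_norm A)\<^sup>2)"
proof -
  have "mat_trace (mat_adjoint A * A) =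
      (\<Sum>j<dim_col A. \<Sum>i<dim_row A. complex_of_real ((cmod (A $$ (i, j)))\<^sup>2))"
    unfolding mat_trace_def
    by (auto simp: scalar_prod_def lessThan_atLeast0 mult.commute
        intro!: sum.cong simp flip: complex_norm_square)
  also have "\<dots> = complex_of_real ((frob_norm A)\<^sup>2)"
    unfolding frob_norm_sq by (subst sum.swap) simp
  finally show ?thesis .
qed

section \<open>Gradients under linear substitutions\<close>

lemma has_block_gradient_carrier:
  "has_block_gradient f Z c G \<Longrightarrow> Z c \<in> carrier_mat m q \<Longrightarrow> G \<in> carrier_mat m q"
  by (simp add: has_block_gradient_def)

text \<open>Chain rule for the substitution of \<open>M * E\<close> for \<open>E\<close>: moving
  \<open>M\<close> across the trace pairing makes it act on \<open>G\<close> as its adjoint.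
  \<open>g\<close> is linked to \<open>f\<close> only along block \<open>c\<close>, which is all
  that a block gradient tests.\<close>

lemma has_block_gradient_linear_chain:
  assumes grad: "has_block_gradient f Z c G"
    and M: "M \<in> carrier_mat m n"
    and Z: "Z c \<in> carrier_mat m q"
    and Z': "Z' c \<in> carrier_mat n q"
    and base: "g Z' = f Z"
    and shift: "\<And>E. E \<in> carrier_mat n q \<Longrightarrow> g (Z'(c := Z' c + E)) = f (Z(c := Z c + M * E))"
  shows "has_block_gradient g Z' c (mat_adjoint M * G)"
  unfolding has_block_gradient_def
proof (intro conjI allI impI)
  have G: "G \<in> carrier_mat m q"
    by (rule has_block_gradient_carrier[where Z = Z, OF grad Z])
  then show "mat_adjoint M * G \<in> carrier_mat (dim_row (Z' c)) (dim_col (Z' c))"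
    using mult_carrier_mat[OF mat_adjoint_carrier[OF M]] carrier_matD[OF Z'] by simp
  fix \<epsilon> :: real assume "\<epsilon> > 0"
  \<comment> \<open>The summand 1 keeps \<open>b\<close> positive even when \<open>M\<close> is
    zero, so that \<open>\<epsilon>\<close> and \<open>\<delta>\<close> can be divided by
    it.\<close>
  define b where "b = frob_norm M + 1"
  have b: "b > 0" unfolding b_def by (simp add: add_nonneg_pos)
  with \<open>\<epsilon> > 0\<close> have "\<epsilon> / b > 0" by simp
  then obtain \<delta> where "\<delta> > 0" and \<delta>: "\<And>E. E \<in> carrier_mat m q \<Longrightarrow> frob_norm E < \<delta> \<Longrightarrow>
      \<bar>f (Z(c := Z c + E)) - f Z - Re (mat_trace (mat_adjoint G * E))\<bar> \<le> \<epsilon> / b * frob_norm E"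
    using grad Z unfolding has_block_gradient_def by (metis carrier_matD)
  show "\<exists>\<delta>>0. \<forall>E\<in>carrier_mat (dim_row (Z' c)) (dim_col (Z' c)). frob_norm E < \<delta> \<longrightarrow>
      \<bar>g (Z'(c := Z' c + E)) - g Z' - Re (mat_trace (mat_adjoint (mat_adjoint M * G) * E))\<bar>
        \<le> \<epsilon> * frob_norm E"
  \<comment> \<open>Since \<open>M * E\<close> is at most \<open>b\<close> times as large as
    \<open>E\<close>, the radius \<open>\<delta> / b\<close> keeps it within
    \<open>\<delta>\<close>, and the factor \<open>b\<close> turns the tolerance
    \<open>\<epsilon> / b\<close> back into \<open>\<epsilon>\<close>.\<close>
  proof (intro exI[of _ "\<delta> / b"] conjI ballI impI)
    show "\<delta> / b > 0" using \<open>\<delta> > 0\<close> b by simp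
    fix E assume "E \<in> carrier_mat (dim_row (Z' c)) (dim_col (Z' c))" and small: "frob_norm E < \<delta> / b"
    then have E: "E \<in> carrier_mat n q" using Z' by auto
    have "frob_norm (M * E) \<le> frob_norm M * frob_norm E"
      using M E by (intro frob_norm_mult_le) auto
    also have "\<dots> \<le> b * frob_norm E"
      unfolding b_def by (simp add: mult_right_mono)
    finally have le: "frob_norm (M * E) \<le> b * frob_norm E" .
    also have "\<dots> < \<delta>" using small b by (simp add: field_simps)
    finally have lt: "frob_norm (M * E) < \<delta>" .
    have "mat_adjoint (mat_adjoint M * G) * E = mat_adjoint G * (M * E)"
      using M G E by (simp add: mat_adjoint_mult mult_assoc_right_dims)
    then have "\<bar>g (Z'(c := Z' c + E)) - g Z' - Re (mat_trace (mat_adjoint (mat_adjoint M * G) * E))\<bar>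
        \<le> \<epsilon> / b * frob_norm (M * E)"
      using \<delta>[OF _ lt] M E base shift[OF E] by simp
    also have "\<dots> \<le> \<epsilon> / b * (b * frob_norm E)"
      using le \<open>\<epsilon> / b > 0\<close> by (intro mult_left_mono) auto
    also have "\<dots> = \<epsilon> * frob_norm E" using b by simp
    finally show "\<bar>g (Z'(c := Z' c + E)) - g Z' -
        Re (mat_trace (mat_adjoint (mat_adjoint M * G) * E))\<bar> \<le> \<epsilon> * frob_norm E" .
  qed
qed

text \<open>Left multiplication by \<open>mat_adjoint M\<close> carries the whole Lagrange equation
  over with the same multiplier. \<open>W\<close> is separate from \<open>Z c\<close> because the
  constraint term is \<open>V c\<close> in one problem and \<open>gram K L Nr H c * X c\<close> in
  the other.\<close>

lemma lagrange_condition_pullback: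
  assumes lagrange: "\<exists>G. has_block_gradient f Z c G \<and> G + \<mu> \<cdot>\<^sub>m W = 0\<^sub>m m q"
    and M: "M \<in> carrier_mat m n"
    and Z: "Z c \<in> carrier_mat m q"
    and Z': "Z' c \<in> carrier_mat n q"
    and W: "W \<in> carrier_mat m q"
    and base: "g Z' = f Z"
    and shift: "\<And>E. E \<in> carrier_mat n q \<Longrightarrow> g (Z'(c := Z' c + E)) = f (Z(c := Z c + M * E))"
  shows "\<exists>G. has_block_gradient g Z' c G \<and> G + \<mu> \<cdot>\<^sub>m (mat_adjoint M * W) = 0\<^sub>m n q"
proof -
  note M' = mat_adjoint_carrier[OF M]
  from lagrange obtain G where grad: "has_block_gradient f Z c G"
    and zero: "G + \<mu> \<cdot>\<^sub>m W = 0\<^sub>m m q" by blast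
  note G = has_block_gradient_carrier[where Z = Z, OF grad Z]
  have "mat_adjoint M * G + \<mu> \<cdot>\<^sub>m (mat_adjoint M * W) = mat_adjoint M * (G + \<mu> \<cdot>\<^sub>m W)"
    using mult_add_distrib_mat[OF M' G smult_carrier_mat[OF W]] mult_smult_distrib[OF M' W] by simp
  with has_block_gradient_linear_chain[where g = g, OF grad M Z Z' base shift] show ?thesis
    unfolding zero right_mult_zero_mat[OF M'] by blast
qed

section \<open>Full row rank and the Gram matrix\<close>

lemma (in vec_space) full_row_rank_surjective:
  assumes A: "A \<in> carrier_mat n nc" and rank: "rank A = n" and v: "v \<in> carrier_vec n"
  shows "\<exists>x\<in>carrier_vec nc. A *\<^sub>v x = v"
proof -
  have cols: "set (cols A) \<subseteq> carrier_vec n" using A cols_dim by blast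
  obtain S where S: "maximal S (\<lambda>T. T \<subseteq> set (cols A) \<and> lin_indpt T)"
    using maximal_exists_superset[of "set (cols A)" "\<lambda>T. T \<subseteq> set (cols A) \<and> lin_indpt T" "{}"]
      finite_lin_indpt2[of "{}"] by auto
  then have sub: "S \<subseteq> set (cols A)" and li: "lin_indpt S"
    by (auto simp: maximal_def)
  \<comment> \<open>\<open>S\<close> has \<open>rank A = n\<close> elements, as many as the
    dimension, so independence makes it a basis; its span lies in the column space.\<close>
  have "basis S"
    using dim_li_is_basis[of S] fin_dim sub li cols rank_card_indpt[OF A S] rank dim_is_n
      finite_subset[OF sub] by auto
  then have "carrier_vec n \<subseteq> col_space A"
    using span_is_monotone[OF sub] unfolding basis_def col_space_def by auto
  then show ?thesis
    using col_space_eq[OF A] A v by auto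
qed

text \<open>The kernel is trivial: if the Gram matrix kills \<open>v\<close>, then so does
  \<open>mat_adjoint A\<close>, hence \<open>v\<close> is orthogonal to the range of
  \<open>A\<close>, which is the whole space by surjectivity.\<close>

lemma full_row_rank_gram_invertible:
  fixes A :: "complex mat"
  assumes A: "A \<in> carrier_mat n nc" and rank: "vec_space.rank n A = n"
  obtains R where "R \<in> carrier_mat n n" "A * mat_adjoint A * R = 1\<^sub>m n" "R * (A * mat_adjoint A) = 1\<^sub>m n"
proof -
  let ?Q = "A * mat_adjoint A"
  have Q: "?Q \<in> carrier_mat n n" using A by auto
  have inner: "(mat_adjoint A *\<^sub>v w) \<bullet>c x = w \<bullet>c (A *\<^sub>v x)"
    if w: "w \<in> carrier_vec n" and x: "x \<in> carrier_vec nc" for w x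
  proof -
    have "(mat_adjoint A *\<^sub>v w) \<bullet>c x = (\<Sum>j<nc. \<Sum>i<n. cnj (A $$ (i, j)) * w $ i * cnj (x $ j))"
      using A w x by (auto simp: scalar_prod_def lessThan_atLeast0 sum_distrib_right intro!: sum.cong)
    also have "\<dots> = (\<Sum>i<n. \<Sum>j<nc. cnj (A $$ (i, j)) * w $ i * cnj (x $ j))"
      by (rule sum.swap)
    also have "\<dots> = w \<bullet>c (A *\<^sub>v x)"
      using A w x
      by (auto simp: scalar_prod_def lessThan_atLeast0 sum_distrib_left mult_ac intro!: sum.cong)
    finally show ?thesis .
  qed
  have "det ?Q \<noteq> 0"
  proof
    assume "det ?Q = 0"
    then obtain v where v: "v \<in> carrier_vec n" "v \<noteq> 0\<^sub>v n" and "?Q *\<^sub>v v = 0\<^sub>v n"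
      using det_0_iff_vec_prod_zero_field[OF Q] by auto
    then have Qv: "A *\<^sub>v (mat_adjoint A *\<^sub>v v) = 0\<^sub>v n"
      using A by (metis assoc_mult_mat_vec mat_adjoint_carrier)
    have Av: "mat_adjoint A *\<^sub>v v \<in> carrier_vec nc"
      using A v by (intro mult_mat_vec_carrier) auto
    \<comment> \<open>Choosing \<open>x\<close> as \<open>mat_adjoint A *\<^sub>v v\<close> makes
      one side of \<open>inner\<close> a squared norm, while the other pairs \<open>v\<close> with
      zero.\<close>
    from inner[OF v(1) Av] v(1) have "(mat_adjoint A *\<^sub>v v) \<bullet>c (mat_adjoint A *\<^sub>v v) = 0"
      unfolding Qv by simp
    then have zero: "mat_adjoint A *\<^sub>v v = 0\<^sub>v nc"
      using Av by (simp only: conjugate_square_eq_0_vec)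
    obtain x where x: "x \<in> carrier_vec nc" "A *\<^sub>v x = v"
      using vec_space.full_row_rank_surjective[OF A rank v(1)] by auto
    from inner[OF v(1) x(1)] x have "v \<bullet>c v = 0"
      unfolding zero by simp
    then show False using v conjugate_square_eq_0_vec[OF v(1)] by simp
  qed
  from det_non_zero_imp_unit[OF Q this, of "()"] show ?thesis
    unfolding Units_def ring_mat_def using that by auto
qed

section \<open>Rates as functions of channel-beamformer products\<close>

lemma rate_via_products:
  assumes A: "A k \<in> carrier_mat Nr n" and B: "\<And>j. j < K \<Longrightarrow> B j \<in> carrier_mat n (d j)"
    and k: "k < K"
  shows "rate K Nr d \<sigma> A B k =
     ln (Re (det (1\<^sub>m (d k) + mat_adjoint (A k * B k) *
       the (mat_inverse (complex_of_real ((\<sigma> k)\<^sup>2) \<cdot>\<^sub>m 1\<^sub>m Nr +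
         msum Nr Nr ({..<K} - {k}) (\<lambda>j. (A k * B j) * mat_adjoint (A k * B j)))) * (A k * B k))))"
proof -
  have "A k * B j * mat_adjoint (B j) * mat_adjoint (A k) = (A k * B j) * mat_adjoint (A k * B j)"
    if "j < K" for j
    using A B[OF that] by (simp add: mat_adjoint_mult mult_assoc_right_dims)
  then have "interference_cov K Nr \<sigma> A B k = complex_of_real ((\<sigma> k)\<^sup>2) \<cdot>\<^sub>m 1\<^sub>m Nr +
      msum Nr Nr ({..<K} - {k}) (\<lambda>j. (A k * B j) * mat_adjoint (A k * B j))"
    unfolding interference_cov_def msum_def by (auto intro!: arg_cong2[of _ _ _ _ "(+)"] eq_matI sum.cong)
  moreover have "Y * A k * B k = Y * (A k * B k)" for Y
    using A B[OF k] by (intro mult_assoc_right_dims) auto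
  moreover have "mat_adjoint (B k) * mat_adjoint (A k) = mat_adjoint (A k * B k)"
    using A B[OF k] by (simp add: mat_adjoint_mult)
  ultimately show ?thesis
    unfolding rate_def by simp
qed

text \<open>The inner dimensions \<open>n\<close> and \<open>n'\<close> may differ, since only the
  products enter the rate; the two problems have \<open>C * L\<close> and
  \<open>C * (K * Nr)\<close> there.\<close>

lemma rate_cong_products:
  assumes "A k \<in> carrier_mat Nr n" "\<And>j. j < K \<Longrightarrow> B j \<in> carrier_mat n (d j)"
    and "A' k \<in> carrier_mat Nr n'" "\<And>j. j < K \<Longrightarrow> B' j \<in> carrier_mat n' (d j)"
    and k: "k < K" and eq: "\<And>j. j < K \<Longrightarrow> A k * B j = A' k * B' j"
  shows "rate K Nr d \<sigma> A B k = rate K Nr d \<sigma> A' B' k"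
proof -
  have "msum Nr Nr ({..<K} - {k}) (\<lambda>j. (A k * B j) * mat_adjoint (A k * B j)) =
      msum Nr Nr ({..<K} - {k}) (\<lambda>j. (A' k * B' j) * mat_adjoint (A' k * B' j))"
    unfolding msum_def by (auto intro!: eq_matI sum.cong simp: eq)
  then show ?thesis
    using assms by (simp add: rate_via_products)
qed

section \<open>Products of stacked matrices\<close>

lemma hcat_mult_vcat_index:
  assumes "i < nr" "j < nc"
  shows "(hcat nr n C A * vcat n nc C B) $$ (i, j) = (\<Sum>c<C. \<Sum>l<n. A c $$ (i, l) * B c $$ (l, j))"
proof -
  \<comment> \<open>An inner index \<open>s = c * n + l\<close> is split into its block
    \<open>c\<close> and its offset \<open>l\<close>.\<close>
  let ?g = "\<lambda>s. A (s div n) $$ (i, s mod n) * B (s div n) $$ (s mod n, j)"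
  have "(hcat nr n C A * vcat n nc C B) $$ (i, j) = (\<Sum>s<C * n. ?g s)"
    using assms by (simp add: hcat_def vcat_def scalar_prod_def lessThan_atLeast0)
  also have "\<dots> = (\<Sum>c<C. \<Sum>s\<in>{c * n..<c * n + n}. ?g s)"
    by (simp add: sum.nat_group)
  also have "\<dots> = (\<Sum>c<C. \<Sum>l<n. ?g (c * n + l))"
    using sum.shift_bounds_nat_ivl[of ?g 0 "_ * n" n]
    by (intro sum.cong[OF refl, where A = "{..<C}"])
      (simp add: add.commute lessThan_atLeast0 del: div_mult_self3)
  finally show ?thesis by simp
qed

text \<open>The users' columns lie side by side, so those of user \<open>k\<close> start after the
  columns of all earlier users. The result is written with the cluster products
  \<open>A c * Z c\<close>, through which the two problems are compared.\<close>

lemma hcat_mult_user_stack: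
  assumes A: "\<And>c. c < C \<Longrightarrow> A c \<in> carrier_mat nr n"
    and Z: "\<And>c. c < C \<Longrightarrow> Z c \<in> carrier_mat n (\<Sum>k<K. d k)" and k: "k < K"
  shows "hcat nr n C A * user_stack n C d Z k =
    mat nr (d k) (\<lambda>(i, j). \<Sum>c<C. (A c * Z c) $$ (i, (\<Sum>l<k. d l) + j))"
proof (rule eq_matI)
  fix i j assume "i < dim_row (mat nr (d k) (\<lambda>(i, j). \<Sum>c<C. (A c * Z c) $$ (i, (\<Sum>l<k. d l) + j)))"
    "j < dim_col (mat nr (d k) (\<lambda>(i, j). \<Sum>c<C. (A c * Z c) $$ (i, (\<Sum>l<k. d l) + j)))"
  then have ij: "i < nr" "j < d k" by auto
  \<comment> \<open>The columns of user \<open>k\<close> end before this bound, hence column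
    \<open>p\<close> lies inside \<open>Z c\<close>.\<close>
  have "(\<Sum>l<Suc k. d l) \<le> (\<Sum>k<K. d k)"
    using k by (intro sum_mono2) auto
  define p where "p = (\<Sum>l<k. d l) + j"
  have p: "p < (\<Sum>k<K. d k)"
    using \<open>(\<Sum>l<Suc k. d l) \<le> (\<Sum>k<K. d k)\<close> ij(2) by (simp add: p_def)
  have "(\<Sum>l<n. A c $$ (i, l) * user_block d (Z c) k $$ (l, j)) = (A c * Z c) $$ (i, p)"
    if c: "c < C" for c
  proof -
    have "user_block d (Z c) k $$ (l, j) = Z c $$ (l, p)" if "l < n" for l
      using that ij(2) carrier_matD(1)[OF Z[OF c]] by (simp add: user_block_def p_def)
    then show ?thesis
      using ij(1) p carrier_matD[OF A[OF c]] carrier_matD[OF Z[OF c]]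
      by (simp add: scalar_prod_def lessThan_atLeast0)
  qed
  then show "(hcat nr n C A * user_stack n C d Z k) $$ (i, j) =
      mat nr (d k) (\<lambda>(i, j). \<Sum>c<C. (A c * Z c) $$ (i, (\<Sum>l<k. d l) + j)) $$ (i, j)"
    unfolding user_stack_def hcat_mult_vcat_index[OF ij] using ij by (simp flip: p_def)
qed (auto simp: hcat_def user_stack_def vcat_def)

section \<open>Cluster channels and equality of the two rates\<close>

lemma cluster_channel_carrier: "cluster_channel K L Nr H c \<in> carrier_mat (K * Nr) L"
  by (simp add: cluster_channel_def vcat_def)

text \<open>The rows \<open>k * Nr + i\<close> of the stacked channel are the rows of
  \<open>H k c\<close>, so equal stacked products agree on each user's row block.\<close>

lemma cluster_channel_mult_cancel:
  assumes H: "H k c \<in> carrier_mat Nr L" and k: "k < K"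
    and U: "U \<in> carrier_mat L q" and W: "W \<in> carrier_mat L q"
    and eq: "cluster_channel K L Nr H c * U = cluster_channel K L Nr H c * W"
  shows "H k c * U = H k c * W"
proof -
  have entry: "(H k c * T) $$ (i, j) = (cluster_channel K L Nr H c * T) $$ (k * Nr + i, j)"
    if T: "T \<in> carrier_mat L q" and i: "i < Nr" and j: "j < q" for T i j
  proof -
    have "k * Nr + i < Suc k * Nr" using i by simp
    also have "\<dots> \<le> K * Nr" using k by (intro mult_right_mono) auto
    finally have "k * Nr + i < K * Nr" .
    then show ?thesis
      using H T i j by (auto simp: cluster_channel_def vcat_def scalar_prod_def)
  qed
  show ?thesis
    using carrier_matD[OF H] carrier_matD[OF U] carrier_matD[OF W]
    by (intro eq_matI) (simp_all add: entry[OF U] entry[OF W] eq del: index_mult_mat(1))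
qed

text \<open>Hypothesis \<open>eq\<close> leaves the part of \<open>W c\<close> in the kernel of the
  cluster channel free. This covers arbitrary increments of \<open>V c\<close>, which may leave the
  range of the adjoint channel.\<close>

lemma original_rate_eq_reduced_rate:
  assumes H: "\<And>k c. k < K \<Longrightarrow> c < C \<Longrightarrow> H k c \<in> carrier_mat Nr L" and k: "k < K"
    and W: "\<And>c. c < C \<Longrightarrow> W c \<in> carrier_mat L (\<Sum>k<K. d k)"
    and Y: "\<And>c. c < C \<Longrightarrow> Y c \<in> carrier_mat (K * Nr) (\<Sum>k<K. d k)"
    and eq: "\<And>c. c < C \<Longrightarrow> cluster_channel K L Nr H c * W c = gram K L Nr H c * Y c"
  shows "original_rate K C L Nr d H \<sigma> W k = reduced_rate K C L Nr d H \<sigma> Y k"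
proof -
  let ?B = "cluster_channel K L Nr H"
  note B = cluster_channel_carrier[of K L Nr H]
  \<comment> \<open>\<open>gram\<close> starts with the same stacked channel as the left side of
    \<open>eq\<close>, so the equation can be restricted to the rows of user
    \<open>k\<close>.\<close>
  have prod: "H k c * W c = H k c * mat_adjoint (?B c) * Y c" if c: "c < C" for c
  proof -
    have "?B c * W c = ?B c * (mat_adjoint (?B c) * Y c)"
      using B[of c] Y[OF c] eq[OF c] unfolding gram_def by (simp add: mult_assoc_right_dims)
    then have "H k c * W c = H k c * (mat_adjoint (?B c) * Y c)"
      by (rule cluster_channel_mult_cancel[where H = H and c = c, OF H[OF k c] k W[OF c]
            mult_carrier_mat[OF mat_adjoint_carrier[OF B] Y[OF c]]])
    then show ?thesis
      using B[of c] Y[OF c] by (simp add: mult_assoc_right_dims)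
  qed
  have HB: "H k c * mat_adjoint (?B c) \<in> carrier_mat Nr (K * Nr)" if "c < C" for c
    by (rule mult_carrier_mat[OF H[OF k that] mat_adjoint_carrier[OF B]])
  show ?thesis
    unfolding original_rate_def reduced_rate_def
  proof (rule rate_cong_products[where n = "C * L" and n' = "C * (K * Nr)", OF _ _ _ _ k])
    fix j assume j: "j < K"
    show "user_channel C L Nr H k * user_stack L C d W j =
        reduced_channel K C L Nr H k * user_stack (K * Nr) C d Y j"
    proof -
      have "user_channel C L Nr H k * user_stack L C d W j =
          mat Nr (d j) (\<lambda>(i, t). \<Sum>c<C. (H k c * W c) $$ (i, (\<Sum>l<j. d l) + t))"
        unfolding user_channel_def by (rule hcat_mult_user_stack[OF H[OF k] W j])
      also have "\<dots> = mat Nr (d j) (\<lambda>(i, t). \<Sum>c<C.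
          (H k c * mat_adjoint (?B c) * Y c) $$ (i, (\<Sum>l<j. d l) + t))"
        by (simp add: prod)
      also have "\<dots> = reduced_channel K C L Nr H k * user_stack (K * Nr) C d Y j"
        unfolding reduced_channel_def by (rule hcat_mult_user_stack[OF HB Y j, symmetric])
      finally show ?thesis .
    qed
  qed (auto simp: user_channel_def reduced_channel_def user_stack_def hcat_def vcat_def)
qed

section \<open>Transfer of the Lagrange conditions\<close>

theorem proposition3:
  fixes K C L Nr :: nat
    and d :: "nat \<Rightarrow> nat"
    and H :: "nat \<Rightarrow> nat \<Rightarrow> complex mat"
    and \<omega> \<sigma> P :: "nat \<Rightarrow> real"
    and X V :: "nat \<Rightarrow> complex mat"
  assumes "K > 0" and "C > 0" and "L > 0" and "Nr > 0"
    and "\<And>k. k < K \<Longrightarrow> 1 \<le> d k \<and> d k \<le> min (L * C) Nr"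
    and "\<And>k. k < K \<Longrightarrow> \<omega> k > 0"
    and "\<And>k. k < K \<Longrightarrow> (\<sigma> k)\<^sup>2 > 0"
    and "\<And>c. c < C \<Longrightarrow> P c > 0"
    and "\<And>k c. k < K \<Longrightarrow> c < C \<Longrightarrow> H k c \<in> carrier_mat Nr L"
    and "\<And>c. c < C \<Longrightarrow> vec_space.rank (K * Nr) (cluster_channel K L Nr H c) = K * Nr"
    and "X \<in> reduced_manifold K C L Nr d H P"
    and "\<And>c. c < C \<Longrightarrow> V c = mat_adjoint (cluster_channel K L Nr H c) * X c"
  shows "reduced_stationary K C L Nr d H \<omega> \<sigma> P X \<longleftrightarrow>
         original_stationary K C L Nr d H \<omega> \<sigma> P V"
proof -
  let ?B = "cluster_channel K L Nr H" and ?Q = "gram K L Nr H" and ?D = "\<Sum>k<K. d k"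
  let ?f = "\<lambda>W. - (\<Sum>k<K. \<omega> k * original_rate K C L Nr d H \<sigma> W k)"
  let ?h = "\<lambda>Y. - (\<Sum>k<K. \<omega> k * reduced_rate K C L Nr d H \<sigma> Y k)"
  note H = assms(9) and VX = assms(12)
  have B: "?B c \<in> carrier_mat (K * Nr) L" for c
    by (rule cluster_channel_carrier)
  have Q: "?Q c \<in> carrier_mat (K * Nr) (K * Nr)" for c
    unfolding gram_def by (rule mult_carrier_mat[OF B mat_adjoint_carrier[OF B]])
  have X: "X c \<in> carrier_mat (K * Nr) ?D" if "c < C" for c
    using assms(11) that by (simp add: reduced_manifold_def)
  have V: "V c \<in> carrier_mat L ?D" if "c < C" for c
    unfolding VX[OF that] by (rule mult_carrier_mat[OF mat_adjoint_carrier[OF B] X[OF that]])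
  have BV: "?B c * V c = ?Q c * X c" if "c < C" for c
    using VX[OF that] X[OF that] B[of c] by (simp add: gram_def mult_assoc_right_dims)
  have f_eq_h: "?f W = ?h Y"
    if "\<And>c. c < C \<Longrightarrow> W c \<in> carrier_mat L ?D" "\<And>c. c < C \<Longrightarrow> Y c \<in> carrier_mat (K * Nr) ?D"
      "\<And>c. c < C \<Longrightarrow> ?B c * W c = ?Q c * Y c" for W Y
    using original_rate_eq_reduced_rate[OF H _ that] by simp
  have f_V_eq_h_X: "?f V = ?h X"
    using V X BV by (rule f_eq_h)
  \<comment> \<open>Increments related like the base points preserve the relation \<open>BV\<close>
    at block \<open>c\<close>. This supplies the \<open>shift\<close> hypothesis of the pullback in
    both directions.\<close>
  have update: "?f (V(c := V c + E)) = ?h (X(c := X c + F))"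
    if "c < C" and E: "E \<in> carrier_mat L ?D" and F: "F \<in> carrier_mat (K * Nr) ?D"
      and "?B c * E = ?Q c * F" for c E F
  proof (rule f_eq_h)
    fix b assume b: "b < C"
    show "?B b * (V(c := V c + E)) b = ?Q b * (X(c := X c + F)) b"
      using that(4) BV[OF b]
        mult_add_distrib_mat[OF B[of b] V[OF b] E] mult_add_distrib_mat[OF Q[of b] X[OF b] F]
      by (cases "b = c") simp_all
  qed (simp_all add: V X E F)
  have B_adjoint_B: "?B c * (mat_adjoint (?B c) * E) = ?Q c * E"
    if "E \<in> carrier_mat (K * Nr) q" for c q and E
    using assoc_mult_mat[OF B mat_adjoint_carrier[OF B] that] by (simp add: gram_def)
  have mat_adjoint_gram: "mat_adjoint (?Q c) = ?Q c" for c
    using B[of c] by (simp add: gram_def mat_adjoint_mult)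
  \<comment> \<open>The trace in the constraint on \<open>X c\<close> is the squared norm of
    \<open>V c\<close>, because \<open>gram\<close> is the channel times its adjoint.\<close>
  have "V \<in> original_feasible K C L d P"
  proof -
    have "complex_of_real ((frob_norm (V c))\<^sup>2) = complex_of_real (P c)" if c: "c < C" for c
    proof -
      have "mat_adjoint (V c) * V c = mat_adjoint (X c) * ?Q c * X c"
        using VX[OF c] X[OF c] B[of c]
        by (simp add: gram_def mat_adjoint_mult mult_assoc_right_dims)
      then show ?thesis
        using assms(11) c unfolding mat_trace_adjoint_mult_self[symmetric]
        by (simp add: reduced_manifold_def)
    qed
    then show ?thesis
      using V unfolding original_feasible_def of_real_eq_iff by auto
  qed
  \<comment> \<open>The equivalence holds for each cluster and each fixed multiplier, so the same
    \<open>\<mu>\<close> serves both problems.\<close>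
  moreover have "(\<exists>G. has_block_gradient ?h X c G \<and>
        G + complex_of_real m \<cdot>\<^sub>m (?Q c * X c) = 0\<^sub>m (K * Nr) ?D) \<longleftrightarrow>
      (\<exists>G. has_block_gradient ?f V c G \<and> G + complex_of_real m \<cdot>\<^sub>m V c = 0\<^sub>m L ?D)"
    (is "?red \<longleftrightarrow> ?orig") if c: "c < C" for c m
  proof
    \<comment> \<open>Here \<open>M\<close> is \<open>mat_adjoint (?B c)\<close>, whose adjoint
      sends \<open>V c\<close> to \<open>?B c * V c = ?Q c * X c\<close>.\<close>
    assume ?orig
    from lagrange_condition_pullback[where Z = V and Z' = X and f = ?f and g = ?h and c = c,
        OF this mat_adjoint_carrier[OF B] V[OF c] X[OF c] V[OF c] f_V_eq_h_X[symmetric]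
          update[OF c mult_carrier_mat[OF mat_adjoint_carrier[OF B]] _ B_adjoint_B, symmetric]]
    show ?red
      by (simp add: BV[OF c])
  next
    assume ?red
    \<comment> \<open>Here \<open>M\<close> is \<open>R * ?B c\<close>, which takes increments of
      \<open>V c\<close> to increments of \<open>X c\<close>.\<close>
    obtain R where R: "R \<in> carrier_mat (K * Nr) (K * Nr)"
      and QR: "?Q c * R = 1\<^sub>m (K * Nr)"
      by (rule full_row_rank_gram_invertible[OF B assms(10)[OF c], folded gram_def])
    note RB = mult_carrier_mat[OF R B[of c]]
    \<comment> \<open>This identity is used twice: its adjoint turns \<open>?Q c * X c\<close> into
      \<open>V c\<close>, and applied to \<open>E\<close> it gives the relation that
      \<open>update\<close> asks for.\<close>
    have QRB: "?Q c * (R * ?B c) = ?B c"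
      using assoc_mult_mat[OF Q[of c] R B[of c]] left_mult_one_mat[OF B[of c]] unfolding QR by simp
    have "mat_adjoint (R * ?B c) * ?Q c = mat_adjoint (?Q c * (R * ?B c))"
      using mat_adjoint_mult[of "?Q c" "R * ?B c"] carrier_matD[OF Q[of c]] carrier_matD[OF RB]
        mat_adjoint_gram[of c] by simp
    then have V_eq: "mat_adjoint (R * ?B c) * (?Q c * X c) = V c"
      using assoc_mult_mat[OF mat_adjoint_carrier[OF RB] Q[of c] X[OF c]]
      unfolding QRB VX[OF c] by simp
    have "?B c * E = ?Q c * (R * ?B c * E)" if "E \<in> carrier_mat L ?D" for E
      using assoc_mult_mat[OF Q[of c] RB that] unfolding QRB .
    from lagrange_condition_pullback[where Z = X and Z' = V and f = ?h and g = ?f and c = c,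
        OF \<open>?red\<close> RB X[OF c] V[OF c] mult_carrier_mat[OF Q X[OF c]] f_V_eq_h_X
          update[OF c _ mult_carrier_mat[OF RB] this]]
    show ?orig
      unfolding V_eq by blast
  qed
  ultimately show ?thesis
    using assms(11) unfolding reduced_stationary_def original_stationary_def by simp
qed

end
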